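(* Let $R$ be a unital von Neumann regular ring and let $X\subseteq R$. Put $\mathbb{L}_R(X):=\{xR\mid x\in X\}$. Then the following are equivalent: (i) There exists a partial Banaschewski function on $\mathbb{L}_R(X)$ in the lattice $\mathbb{L}(R)$. (ii) There exists a partial Banaschewski function on $X$ in the ring $R$.
   Context: A ring $R$ is von Neumann regular if for each $x\in R$ there is $y\in R$ with $xyx=x$. For such $R$, $\mathbb{L}(R):=\{xR\mid x\in R\}$ is the set of all principal right ideals of $R$, ordered by inclusion; it is a modular lattice (join is the sum, meet is the intersection), and it is bounded with $0=\{0\}$ and $1=R$ when $R$ is unital. In a lattice with zero, $a\oplus b=c$ means $a\wedge b=0$ and $a\vee b=c$. Lattices: for a subset $Y$ of a bounded lattice $L$, a partial Banaschewski function on $Y$ in $L$ is an antitone (order-reversing) map $f\colon Y\to L$ such that $y\oplus f(y)=1$ for each $y\in Y$. Rings: for idempotents $a,b$ of a ring, $a\trianglelefteq b$ means $a=ab=ba$. For a subset $X$ of a ring $R$, a partial Banaschewski function on $X$ in $R$ is a map $f$ from $X$ to the set of idempotents of $R$ such that $xR=f(x)R$ for each $x\in X$, and $xR\subseteq yR$ implies $f(x)\trianglelefteq f(y)$ for all $x,y\in X$. *)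

theory Defs
  imports "HOL-Algebra.Complete_Lattice" "HOL-Algebra.Ideal"
begin

definition von_neumann_regular :: "('a, 'm) ring_scheme \<Rightarrow> bool" where
  "von_neumann_regular R \<longleftrightarrow>
     (\<forall>x\<in>carrier R. \<exists>y\<in>carrier R. x \<otimes>\<^bsub>R\<^esub> y \<otimes>\<^bsub>R\<^esub> x = x)"

text \<open>The library's \<open>PIdl\<close> is the set of left multiples, so the right ideal \<open>xR\<close> is
  written as the left coset \<open>x <# carrier R\<close>, that is \<open>{x \<otimes> r | r. r \<in> carrier R}\<close>.\<close>

definition principal_right_ideal :: "('a, 'm) ring_scheme \<Rightarrow> 'a \<Rightarrow> 'a set" where
  "principal_right_ideal R x = x <#\<^bsub>R\<^esub> carrier R"

definition principal_right_ideals_of :: "('a, 'm) ring_scheme \<Rightarrow> 'a set \<Rightarrow> 'a set set" where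
  "principal_right_ideals_of R X = principal_right_ideal R ` X"

text \<open>Only the order is part of the structure. The lattice operations and bounds are those
  derived from it by the library; for regular unital \<open>R\<close> they are the intersection, the sum,
  \<open>{\<zero>}\<close> and \<open>carrier R\<close>.\<close>

definition principal_right_ideal_lattice :: "('a, 'm) ring_scheme \<Rightarrow> 'a set gorder" where
  "principal_right_ideal_lattice R =
     \<lparr>carrier = principal_right_ideals_of R (carrier R), eq = (=), le = (\<subseteq>)\<rparr>"

text \<open>\<open>lattice_direct_sum L a b c\<close> is \<open>a \<oplus> b = c\<close> in the lattice \<open>L\<close>.\<close>

definition lattice_direct_sum :: "('a, 'm) gorder_scheme \<Rightarrow> 'a \<Rightarrow> 'a \<Rightarrow> 'a \<Rightarrow> bool" where
  "lattice_direct_sum L a b c \<longleftrightarrow> a \<sqinter>\<^bsub>L\<^esub> b = \<bottom>\<^bsub>L\<^esub> \<and> a \<squnion>\<^bsub>L\<^esub> b = c"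

text \<open>In both definitions below, a map with the given domain is represented by a total function
  whose values outside that domain are irrelevant.\<close>

definition lattice_partial_Banaschewski ::
    "('a, 'm) gorder_scheme \<Rightarrow> 'a set \<Rightarrow> ('a \<Rightarrow> 'a) \<Rightarrow> bool" where
  "lattice_partial_Banaschewski L Y f \<longleftrightarrow>
     f \<in> Y \<rightarrow> carrier L \<and>
     (\<forall>x\<in>Y. \<forall>y\<in>Y. x \<sqsubseteq>\<^bsub>L\<^esub> y \<longrightarrow> f y \<sqsubseteq>\<^bsub>L\<^esub> f x) \<and>
     (\<forall>y\<in>Y. lattice_direct_sum L y (f y) \<top>\<^bsub>L\<^esub>)"

definition idempotents :: "('a, 'm) ring_scheme \<Rightarrow> 'a set" where
  "idempotents R = {e \<in> carrier R. e \<otimes>\<^bsub>R\<^esub> e = e}"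

definition idempotent_le :: "('a, 'm) ring_scheme \<Rightarrow> 'a \<Rightarrow> 'a \<Rightarrow> bool" where
  "idempotent_le R a b \<longleftrightarrow> a = a \<otimes>\<^bsub>R\<^esub> b \<and> a = b \<otimes>\<^bsub>R\<^esub> a"

definition ring_partial_Banaschewski ::
    "('a, 'm) ring_scheme \<Rightarrow> 'a set \<Rightarrow> ('a \<Rightarrow> 'a) \<Rightarrow> bool" where
  "ring_partial_Banaschewski R X f \<longleftrightarrow>
     f \<in> X \<rightarrow> idempotents R \<and>
     (\<forall>x\<in>X. principal_right_ideal R x = principal_right_ideal R (f x)) \<and>
     (\<forall>x\<in>X. \<forall>y\<in>X. principal_right_ideal R x \<subseteq> principal_right_ideal R y \<longrightarrow>
        idempotent_le R (f x) (f y))"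

end

theory Submission
  imports Defs "HOL-Algebra.Multiplicative_Group"
begin

text \<open>
  A Banaschewski function chooses a complement, and choosing a complement of a right ideal amounts
  to choosing an idempotent generator: \<open>I \<oplus> J = R\<close> holds exactly when \<open>I = eR\<close> and
  \<open>J = (1 - e)R\<close> for some idempotent \<open>e\<close>, namely the component of \<open>1\<close> in \<open>I\<close>
  (\<open>lattice_direct_sum_top_iff\<close>). Under this correspondence the two order conditions agree:
  \<open>ba = a\<close> says \<open>aR \<subseteq> bR\<close>, and \<open>ab = a\<close> says \<open>(1 - b)R \<subseteq> (1 - a)R\<close>, so that
  \<open>a \<unlhd> b\<close> means precisely that the generated ideals grow while the complements shrink
  (\<open>idempotent_le_iff\<close>). Hence \<open>xR \<mapsto> (1 - g x)R\<close> and \<open>x \<mapsto>\<close> (idempotent of the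
  decomposition \<open>xR \<oplus> f (xR)\<close>) translate between the two kinds of functions.

  Regularity enters because the lattice operations are those derived from the order on principal
  right ideals: the intersection and the sum of two such ideals have to be principal again in
  order to be the meet and the join.
\<close>

section \<open>Principal right ideals\<close>

context ring
begin

lemma mem_principal_right_ideal:
  "z \<in> principal_right_ideal R x \<longleftrightarrow> (\<exists>r\<in>carrier R. z = x \<otimes> r)"
  by (auto simp: principal_right_ideal_def l_coset_def)

lemma principal_right_ideal_closed:
  "x \<in> carrier R \<Longrightarrow> principal_right_ideal R x \<subseteq> carrier R"
  by (auto simp: mem_principal_right_ideal)

lemma generator_mem: "x \<in> carrier R \<Longrightarrow> x \<in> principal_right_ideal R x"
  unfolding mem_principal_right_ideal by (metis one_closed r_one)

lemma principal_right_ideal_subset_iff: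
  assumes "x \<in> carrier R" "y \<in> carrier R"
  shows "principal_right_ideal R x \<subseteq> principal_right_ideal R y \<longleftrightarrow>
    x \<in> principal_right_ideal R y"
proof
  assume "x \<in> principal_right_ideal R y"
  then obtain r where r: "r \<in> carrier R" "x = y \<otimes> r"
    by (auto simp: mem_principal_right_ideal)
  show "principal_right_ideal R x \<subseteq> principal_right_ideal R y"
  proof
    fix z assume "z \<in> principal_right_ideal R x"
    then obtain s where "s \<in> carrier R" "z = x \<otimes> s"
      by (auto simp: mem_principal_right_ideal)
    then have "z = y \<otimes> (r \<otimes> s)" "r \<otimes> s \<in> carrier R"
      using r assms by (auto simp: m_assoc)
    then show "z \<in> principal_right_ideal R y"
      by (auto simp: mem_principal_right_ideal)
  qed
qed (use assms generator_mem in blast)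

lemma principal_right_ideal_add_closed:
  assumes "x \<in> carrier R" "u \<in> principal_right_ideal R x" "v \<in> principal_right_ideal R x"
  shows "u \<oplus> v \<in> principal_right_ideal R x"
proof -
  obtain r s where "r \<in> carrier R" "s \<in> carrier R" "u = x \<otimes> r" "v = x \<otimes> s"
    using assms by (auto simp: mem_principal_right_ideal)
  then have "u \<oplus> v = x \<otimes> (r \<oplus> s)" "r \<oplus> s \<in> carrier R"
    using assms by (auto simp: r_distr)
  then show ?thesis
    by (auto simp: mem_principal_right_ideal)
qed

lemma principal_right_ideal_mult_closed:
  assumes "x \<in> carrier R" "u \<in> principal_right_ideal R x" "r \<in> carrier R"
  shows "u \<otimes> r \<in> principal_right_ideal R x"
  using assms unfolding mem_principal_right_ideal by (metis m_assoc m_closed)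

lemma principal_right_ideal_minus_closed:
  assumes "x \<in> carrier R" "u \<in> principal_right_ideal R x" "v \<in> principal_right_ideal R x"
  shows "u \<ominus> v \<in> principal_right_ideal R x"
proof -
  have v: "v \<in> carrier R"
    using assms principal_right_ideal_closed by blast
  then have "v \<otimes> \<ominus> \<one> \<in> principal_right_ideal R x"
    using assms by (intro principal_right_ideal_mult_closed) auto
  then show ?thesis
    using assms v by (auto simp: a_minus_def r_minus intro: principal_right_ideal_add_closed)
qed

lemma zero_mem_principal_right_ideal:
  "x \<in> carrier R \<Longrightarrow> \<zero> \<in> principal_right_ideal R x"
  unfolding mem_principal_right_ideal by (metis r_null zero_closed)

lemma principal_right_ideal_zero: "principal_right_ideal R \<zero> = {\<zero>}"
  using generator_mem[OF zero_closed] by (auto simp: mem_principal_right_ideal)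

lemma principal_right_ideal_one: "principal_right_ideal R \<one> = carrier R"
  by (auto simp: mem_principal_right_ideal)


section \<open>Idempotents\<close>

lemma idempotent_complement:
  assumes "e \<in> idempotents R"
  shows "\<one> \<ominus> e \<in> idempotents R"
  using assms
  by (simp add: idempotents_def a_minus_def l_distr r_distr l_minus r_minus r_neg a_assoc)

text \<open>An idempotent acts as a left identity on the right ideal that it generates, which turns
  membership and inclusion into equations.\<close>

lemma mem_idempotent_ideal:
  assumes "e \<in> idempotents R"
  shows "z \<in> principal_right_ideal R e \<longleftrightarrow> z \<in> carrier R \<and> e \<otimes> z = z"
  using assms unfolding mem_principal_right_ideal idempotents_def
  by (smt (verit) m_assoc m_closed mem_Collect_eq)

lemma idempotent_le_iff:
  assumes a: "a \<in> idempotents R" and b: "b \<in> idempotents R"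
  shows "idempotent_le R a b \<longleftrightarrow>
    principal_right_ideal R a \<subseteq> principal_right_ideal R b \<and>
    principal_right_ideal R (\<one> \<ominus> b) \<subseteq> principal_right_ideal R (\<one> \<ominus> a)"
proof -
  have c: "a \<in> carrier R" "b \<in> carrier R"
    using a b by (auto simp: idempotents_def)
  have "principal_right_ideal R a \<subseteq> principal_right_ideal R b \<longleftrightarrow> b \<otimes> a = a"
    using a b c by (simp add: principal_right_ideal_subset_iff mem_idempotent_ideal)
  moreover have "principal_right_ideal R (\<one> \<ominus> b) \<subseteq> principal_right_ideal R (\<one> \<ominus> a)
      \<longleftrightarrow> (\<one> \<ominus> a) \<otimes> (\<one> \<ominus> b) = \<one> \<ominus> b"
    using a b c
    by (simp add: principal_right_ideal_subset_iff mem_idempotent_ideal idempotent_complement)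
  moreover have "(\<one> \<ominus> a) \<otimes> (\<one> \<ominus> b) = (\<one> \<ominus> b) \<ominus> (a \<ominus> a \<otimes> b)"
    using c by algebra simp
  moreover have "(\<one> \<ominus> b) \<ominus> (a \<ominus> a \<otimes> b) = \<one> \<ominus> b \<longleftrightarrow> a \<ominus> a \<otimes> b = \<zero>"
  proof -
    have "x \<ominus> y = x \<longleftrightarrow> y = \<zero>" if "x \<in> carrier R" "y \<in> carrier R" for x y
      using that by (metis a_minus_def add.inv_closed add.l_cancel_one' add.inv_eq_1_iff)
    then show ?thesis using c by simp
  qed
  ultimately show ?thesis
    using c unfolding idempotent_le_def by (metis m_closed r_right_minus_eq)
qed

text \<open>The projection of \<open>1\<close> onto the first summand generates that summand: multiplying
  \<open>1 = a + b\<close> by an element \<open>z\<close> of \<open>I\<close> gives \<open>bz = z - az\<close>, which lies in \<open>I \<inter> J\<close>.\<close>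

lemma direct_decomposition_idempotent:
  assumes x: "x \<in> carrier R" and y: "y \<in> carrier R"
    and int: "principal_right_ideal R x \<inter> principal_right_ideal R y = {\<zero>}"
    and a: "a \<in> principal_right_ideal R x" and b: "b \<in> principal_right_ideal R y"
    and one: "a \<oplus> b = \<one>"
  shows "a \<in> idempotents R" "principal_right_ideal R a = principal_right_ideal R x"
proof -
  have c: "a \<in> carrier R" "b \<in> carrier R"
    using a b x y principal_right_ideal_closed by blast+
  have fix_I: "a \<otimes> z = z" if z: "z \<in> principal_right_ideal R x" for z
  proof -
    have zc: "z \<in> carrier R"
      using z x principal_right_ideal_closed by blast
    have "z = a \<otimes> z \<oplus> b \<otimes> z"
      using c zc one by (metis l_distr l_one)
    then have "b \<otimes> z = z \<ominus> a \<otimes> z"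
      using c zc by (metis add.m_comm add.inv_solve_right m_closed minus_eq)
    moreover have "z \<ominus> a \<otimes> z \<in> principal_right_ideal R x"
      using a x z zc by (intro principal_right_ideal_minus_closed principal_right_ideal_mult_closed)
    moreover have "b \<otimes> z \<in> principal_right_ideal R y"
      using b y zc by (intro principal_right_ideal_mult_closed)
    ultimately have "z \<ominus> a \<otimes> z = \<zero>"
      using int by auto
    then show ?thesis
      using c zc by (metis m_closed r_right_minus_eq)
  qed
  show "a \<in> idempotents R"
    using fix_I[OF a] c by (simp add: idempotents_def)
  have "x \<in> principal_right_ideal R a"
    using fix_I[OF generator_mem[OF x]] x by (auto simp: mem_principal_right_ideal intro: sym)
  then show "principal_right_ideal R a = principal_right_ideal R x"
    using a c x principal_right_ideal_subset_iff by blast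
qed

lemma complementary_principal_right_ideals_iff:
  assumes x: "x \<in> carrier R" and y: "y \<in> carrier R"
  shows "principal_right_ideal R x \<inter> principal_right_ideal R y = {\<zero>} \<and>
      principal_right_ideal R x <+>\<^bsub>R\<^esub> principal_right_ideal R y = carrier R \<longleftrightarrow>
    (\<exists>e\<in>idempotents R. principal_right_ideal R x = principal_right_ideal R e \<and>
      principal_right_ideal R y = principal_right_ideal R (\<one> \<ominus> e))"
    (is "?complementary \<longleftrightarrow> ?split")
proof
  assume c: ?complementary
  then have "\<one> \<in> principal_right_ideal R x <+>\<^bsub>R\<^esub> principal_right_ideal R y"
    by simp
  then obtain a b where ab: "a \<in> principal_right_ideal R x" "b \<in> principal_right_ideal R y"
    "a \<oplus> b = \<one>"
    by (auto simp: set_add_def')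
  have cc: "a \<in> carrier R" "b \<in> carrier R"
    using ab x y principal_right_ideal_closed by blast+
  have "b = \<one> \<ominus> a"
    using ab cc by (metis add.m_comm add.inv_solve_right minus_eq one_closed)
  moreover have "a \<in> idempotents R" "principal_right_ideal R a = principal_right_ideal R x"
    using direct_decomposition_idempotent[OF x y _ ab] c by auto
  moreover have "principal_right_ideal R b = principal_right_ideal R y"
    using direct_decomposition_idempotent[OF y x _ ab(2,1)] c ab cc
    by (auto simp: a_comm Int_commute)
  ultimately show ?split
    by auto
next
  assume ?split
  then obtain e where e: "e \<in> idempotents R"
    and xe: "principal_right_ideal R x = principal_right_ideal R e"
    and ye: "principal_right_ideal R y = principal_right_ideal R (\<one> \<ominus> e)"
    by blast
  have ec: "e \<in> carrier R" and ee: "e \<otimes> e = e"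
    using e by (auto simp: idempotents_def)
  note mem = mem_idempotent_ideal[OF e] mem_idempotent_ideal[OF idempotent_complement[OF e]]
  have "z = \<zero>" if "z \<in> carrier R" "e \<otimes> z = z" "(\<one> \<ominus> e) \<otimes> z = z" for z
  proof -
    have "(\<one> \<ominus> e) \<otimes> z = z \<ominus> e \<otimes> z"
      using that(1) ec by algebra
    then show ?thesis
      using that by (metis r_right_minus_eq)
  qed
  then have "principal_right_ideal R e \<inter> principal_right_ideal R (\<one> \<ominus> e) = {\<zero>}"
    using ec by (auto simp: mem)
  moreover have "principal_right_ideal R e <+>\<^bsub>R\<^esub> principal_right_ideal R (\<one> \<ominus> e) = carrier R"
  proof
    show "principal_right_ideal R e <+>\<^bsub>R\<^esub> principal_right_ideal R (\<one> \<ominus> e) \<subseteq> carrier R"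
      using ec by (auto simp: set_add_def' mem)
    show "carrier R \<subseteq> principal_right_ideal R e <+>\<^bsub>R\<^esub> principal_right_ideal R (\<one> \<ominus> e)"
    proof
      fix z assume z: "z \<in> carrier R"
      have "z = e \<otimes> z \<oplus> (\<one> \<ominus> e) \<otimes> z"
        using z ec by algebra
      moreover have "e \<otimes> z \<in> principal_right_ideal R e"
        "(\<one> \<ominus> e) \<otimes> z \<in> principal_right_ideal R (\<one> \<ominus> e)"
        using z by (auto simp: mem_principal_right_ideal)
      ultimately show "z \<in> principal_right_ideal R e <+>\<^bsub>R\<^esub> principal_right_ideal R (\<one> \<ominus> e)"
        by (auto simp: set_add_def')
    qed
  qed
  ultimately show ?complementary
    by (simp add: xe ye)
qed


section \<open>Regular rings\<close>

text \<open>If \<open>xyx = x\<close>, then \<open>xy\<close> is an idempotent that generates the same right ideal as \<open>x\<close>.\<close>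

lemma regular_idempotent_generator:
  assumes "von_neumann_regular R" and x: "x \<in> carrier R"
  obtains e where "e \<in> idempotents R" "principal_right_ideal R x = principal_right_ideal R e"
proof -
  obtain y where y: "y \<in> carrier R" "x \<otimes> y \<otimes> x = x"
    using assms by (auto simp: von_neumann_regular_def)
  have "x \<otimes> y \<in> idempotents R"
    using x y by (simp add: idempotents_def) (metis m_assoc m_closed)
  moreover have "x \<in> principal_right_ideal R (x \<otimes> y)"
    using x y by (auto simp: mem_principal_right_ideal intro: sym)
  moreover have "x \<otimes> y \<in> principal_right_ideal R x"
    using y by (auto simp: mem_principal_right_ideal)
  ultimately show thesis
    using that[of "x \<otimes> y"] x y principal_right_ideal_subset_iff by (simp add: subset_antisym)
qed

text \<open>For idempotents \<open>e, f\<close>, an element \<open>z = fz\<close> lies in \<open>eR\<close> exactly when it is annihilated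
  by \<open>a = (1 - e)f\<close>. If \<open>aba = a\<close>, the right annihilator of \<open>a\<close> is \<open>(1 - ba)R\<close>, so
  \<open>eR \<inter> fR\<close> is generated by \<open>f(1 - ba)\<close>.\<close>

lemma regular_inter_principal:
  assumes reg: "von_neumann_regular R" and x: "x \<in> carrier R" and y: "y \<in> carrier R"
  shows "\<exists>w\<in>carrier R. principal_right_ideal R x \<inter> principal_right_ideal R y =
    principal_right_ideal R w"
proof -
  obtain e where e: "e \<in> idempotents R" "principal_right_ideal R x = principal_right_ideal R e"
    using regular_idempotent_generator[OF reg x] .
  obtain f where f: "f \<in> idempotents R" "principal_right_ideal R y = principal_right_ideal R f"
    using regular_idempotent_generator[OF reg y] .
  have ec: "e \<in> carrier R" "e \<otimes> e = e" and fc: "f \<in> carrier R" "f \<otimes> f = f"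
    using e f by (auto simp: idempotents_def)
  define a where "a = (\<one> \<ominus> e) \<otimes> f"
  have ac: "a \<in> carrier R"
    using ec fc by (simp add: a_def)
  obtain b where b: "b \<in> carrier R" "a \<otimes> b \<otimes> a = a"
    using reg ac by (auto simp: von_neumann_regular_def)
  define w where "w = f \<otimes> (\<one> \<ominus> b \<otimes> a)"
  have wc: "w \<in> carrier R"
    using ac b fc by (simp add: w_def)
  have "principal_right_ideal R e \<inter> principal_right_ideal R f \<subseteq> principal_right_ideal R w"
  proof
    fix z assume "z \<in> principal_right_ideal R e \<inter> principal_right_ideal R f"
    then have z: "z \<in> carrier R" "e \<otimes> z = z" "f \<otimes> z = z"
      by (auto simp: mem_idempotent_ideal e f)
    have "a \<otimes> z = (\<one> \<ominus> e) \<otimes> (f \<otimes> z)"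
      using z(1) ec(1) fc(1) by (simp add: a_def m_assoc)
    also have "\<dots> = z \<ominus> e \<otimes> z"
      unfolding z(3) using z(1) ec(1) by algebra
    also have "\<dots> = \<zero>"
      using z by (simp add: r_right_minus_eq)
    finally have az: "a \<otimes> z = \<zero>" .
    have "w \<otimes> z = f \<otimes> z \<ominus> f \<otimes> (b \<otimes> (a \<otimes> z))"
      unfolding w_def using z(1) ac b(1) fc(1) by algebra
    then have "w \<otimes> z = z"
      using z b fc by (simp add: az a_minus_def)
    then show "z \<in> principal_right_ideal R w"
      using z(1) by (auto simp: mem_principal_right_ideal intro: sym)
  qed
  moreover have "w \<in> principal_right_ideal R f"
    using ac b by (auto simp: w_def mem_principal_right_ideal)
  moreover have "w \<in> principal_right_ideal R e"
  proof -
    \<comment> \<open>the defect of \<open>w\<close> from being fixed by \<open>e\<close> is exactly the defect in \<open>aba = a\<close>\<close>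
    have "w \<ominus> e \<otimes> w = a \<ominus> a \<otimes> b \<otimes> a"
    proof -
      have "w \<ominus> e \<otimes> w = (\<one> \<ominus> e) \<otimes> w"
        using ec(1) wc by algebra
      also have "\<dots> = a \<otimes> (\<one> \<ominus> b \<otimes> a)"
        using ec(1) fc(1) ac b(1) by (simp add: w_def a_def m_assoc)
      also have "\<dots> = a \<ominus> a \<otimes> b \<otimes> a"
        using ac b(1) by algebra simp
      finally show ?thesis .
    qed
    then have "w \<ominus> e \<otimes> w = \<zero>"
      using b ac by (simp add: r_right_minus_eq)
    then have "e \<otimes> w = w"
      using ec wc by (metis m_closed r_right_minus_eq)
    then show ?thesis
      using wc by (simp add: mem_idempotent_ideal e)
  qed
  ultimately show ?thesis
    using wc ec fc e f principal_right_ideal_subset_iff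
    by (intro bexI[of _ w]) (auto simp: subset_antisym)
qed

text \<open>With \<open>a = (1 - e)f\<close> and \<open>aba = a\<close> as above, \<open>ab(1 - e)\<close> is an idempotent that
  is orthogonal to \<open>e\<close> and fixes \<open>a\<close>. Its sum with \<open>e\<close> therefore fixes \<open>e\<close> and \<open>f = ef + a\<close>,
  and this sum lies in \<open>eR + fR\<close>.\<close>

lemma regular_sum_principal:
  assumes reg: "von_neumann_regular R" and x: "x \<in> carrier R" and y: "y \<in> carrier R"
  shows "\<exists>w\<in>carrier R. principal_right_ideal R x <+>\<^bsub>R\<^esub> principal_right_ideal R y =
    principal_right_ideal R w"
proof -
  obtain e where e: "e \<in> idempotents R" "principal_right_ideal R x = principal_right_ideal R e"
    using regular_idempotent_generator[OF reg x] .
  obtain f where f: "f \<in> idempotents R" "principal_right_ideal R y = principal_right_ideal R f"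
    using regular_idempotent_generator[OF reg y] .
  have ec: "e \<in> carrier R" "e \<otimes> e = e" and fc: "f \<in> carrier R"
    using e f by (auto simp: idempotents_def)
  define a where "a = (\<one> \<ominus> e) \<otimes> f"
  have ac: "a \<in> carrier R"
    using ec fc by (simp add: a_def)
  obtain b where b: "b \<in> carrier R" "a \<otimes> b \<otimes> a = a"
    using reg ac by (auto simp: von_neumann_regular_def)
  define g where "g = a \<otimes> b \<otimes> (\<one> \<ominus> e)"
  define w where "w = e \<oplus> g"
  have gc: "g \<in> carrier R" and wc: "w \<in> carrier R"
    using ac b ec by (simp_all add: g_def w_def)
  have ce: "(\<one> \<ominus> e) \<otimes> e = \<zero>" and ec0: "e \<otimes> (\<one> \<ominus> e) = \<zero>"
    using ec by (simp_all add: a_minus_def l_distr r_distr l_minus r_minus r_neg)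
  have ea: "e \<otimes> a = \<zero>"
    using ec fc ec0 by (simp add: a_def m_assoc[symmetric])
  have ge: "g \<otimes> e = \<zero>"
    using ac b(1) ec(1) by (simp add: g_def m_assoc ce)
  have ga: "g \<otimes> a = a"
  proof -
    have "g \<otimes> a = a \<otimes> b \<otimes> a \<ominus> a \<otimes> b \<otimes> (e \<otimes> a)"
      unfolding g_def using ac b(1) ec(1) by algebra
    then show ?thesis
      using ac b by (simp add: ea a_minus_def)
  qed
  have we: "w \<otimes> e = e"
    using ec gc by (simp add: w_def l_distr ge)
  have wa: "w \<otimes> a = a"
    using ec gc ac by (simp add: w_def l_distr ga ea)
  have fea: "f = e \<otimes> f \<oplus> a"
    unfolding a_def using ec(1) fc by algebra
  have wf: "w \<otimes> f = f"
  proof -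
    have "w \<otimes> f = w \<otimes> e \<otimes> f \<oplus> w \<otimes> a"
      using fea wc ec(1) fc ac by (metis m_assoc m_closed r_distr)
    then show ?thesis
      using we wa fea by simp
  qed
  have "w \<in> principal_right_ideal R e <+>\<^bsub>R\<^esub> principal_right_ideal R f"
  proof -
    \<comment> \<open>\<open>g = r - er\<close> with \<open>r \<in> fR\<close>, hence \<open>e + g = e(1 - r) + r\<close>\<close>
    define r where "r = f \<otimes> (b \<otimes> (\<one> \<ominus> e))"
    have rc: "r \<in> carrier R"
      using fc b ec by (simp add: r_def)
    have "g = (\<one> \<ominus> e) \<otimes> r"
      using fc b(1) ec(1) by (simp add: r_def g_def a_def m_assoc)
    then have "w = e \<otimes> (\<one> \<ominus> r) \<oplus> r"
      unfolding w_def using ec(1) rc by algebra simp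
    moreover have "e \<otimes> (\<one> \<ominus> r) \<in> principal_right_ideal R e"
      using rc by (auto simp: mem_principal_right_ideal)
    moreover have "r \<in> principal_right_ideal R f"
      using b ec by (auto simp: r_def mem_principal_right_ideal)
    ultimately show ?thesis
      by (auto simp: set_add_def')
  qed
  then obtain u v where uv: "u \<in> carrier R" "v \<in> carrier R" "w = e \<otimes> u \<oplus> f \<otimes> v"
    by (auto simp: set_add_def' mem_principal_right_ideal)
  have "principal_right_ideal R e <+>\<^bsub>R\<^esub> principal_right_ideal R f = principal_right_ideal R w"
  proof
    show "principal_right_ideal R w \<subseteq> principal_right_ideal R e <+>\<^bsub>R\<^esub> principal_right_ideal R f"
    proof
      fix z assume "z \<in> principal_right_ideal R w"
      then obtain t where t: "t \<in> carrier R" "z = w \<otimes> t"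
        by (auto simp: mem_principal_right_ideal)
      have "z = e \<otimes> (u \<otimes> t) \<oplus> f \<otimes> (v \<otimes> t)"
        using t uv ec(1) fc by (simp add: l_distr m_assoc)
      moreover have "e \<otimes> (u \<otimes> t) \<in> principal_right_ideal R e"
        "f \<otimes> (v \<otimes> t) \<in> principal_right_ideal R f"
        using t uv by (auto simp: mem_principal_right_ideal)
      ultimately show "z \<in> principal_right_ideal R e <+>\<^bsub>R\<^esub> principal_right_ideal R f"
        by (auto simp: set_add_def')
    qed
    have "e \<in> principal_right_ideal R w" "f \<in> principal_right_ideal R w"
      using we wf ec fc by (auto simp: mem_principal_right_ideal intro: sym)
    then have "principal_right_ideal R e \<subseteq> principal_right_ideal R w"
      "principal_right_ideal R f \<subseteq> principal_right_ideal R w"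
      using principal_right_ideal_subset_iff ec fc wc by blast+
    then show "principal_right_ideal R e <+>\<^bsub>R\<^esub> principal_right_ideal R f \<subseteq> principal_right_ideal R w"
      using principal_right_ideal_add_closed[OF wc] by (auto simp: set_add_def')
  qed
  then show ?thesis
    using wc e f by auto
qed

end


section \<open>The lattice operations\<close>

text \<open>In a family of sets ordered by inclusion, the operations derived from the order are the
  expected ones as soon as their values belong to the family.\<close>

lemma partial_order_inclusion: "partial_order \<lparr>carrier = C, eq = (=), le = (\<subseteq>)\<rparr>"
  by unfold_locales auto

lemma inclusion_order_meet:
  assumes "A \<in> C" "B \<in> C" "A \<inter> B \<in> C"
  shows "A \<sqinter>\<^bsub>\<lparr>carrier = C, eq = (=), le = (\<subseteq>)\<rparr>\<^esub> B = A \<inter> B"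
proof -
  let ?L = "\<lparr>carrier = C, eq = (=), le = (\<subseteq>)\<rparr>"
  have "greatest ?L (A \<inter> B) (Lower ?L {A, B})"
    using assms by (auto simp: greatest_def Lower_def)
  then show ?thesis
    unfolding meet_def inf_def
    by (intro some_equality partial_order.greatest_unique[OF partial_order_inclusion])
qed

lemma inclusion_order_join:
  assumes "A \<in> C" "B \<in> C" "S \<in> C" "A \<subseteq> S" "B \<subseteq> S"
    and "\<And>T. \<lbrakk>T \<in> C; A \<subseteq> T; B \<subseteq> T\<rbrakk> \<Longrightarrow> S \<subseteq> T"
  shows "A \<squnion>\<^bsub>\<lparr>carrier = C, eq = (=), le = (\<subseteq>)\<rparr>\<^esub> B = S"
proof -
  let ?L = "\<lparr>carrier = C, eq = (=), le = (\<subseteq>)\<rparr>"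
  have "least ?L S (Upper ?L {A, B})"
    using assms by (simp add: least_def Upper_def)
  then show ?thesis
    unfolding join_def sup_def
    by (intro some_equality partial_order.least_unique[OF partial_order_inclusion])
qed

lemma inclusion_order_bottom:
  assumes "Z \<in> C" "\<And>T. T \<in> C \<Longrightarrow> Z \<subseteq> T"
  shows "\<bottom>\<^bsub>\<lparr>carrier = C, eq = (=), le = (\<subseteq>)\<rparr>\<^esub> = Z"
proof -
  let ?L = "\<lparr>carrier = C, eq = (=), le = (\<subseteq>)\<rparr>"
  have "least ?L Z (carrier ?L)"
    using assms by (simp add: least_def)
  then show ?thesis
    unfolding bottom_def
    by (intro some_equality partial_order.least_unique[OF partial_order_inclusion])
qed

lemma inclusion_order_top:
  assumes "U \<in> C" "\<And>T. T \<in> C \<Longrightarrow> T \<subseteq> U"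
  shows "\<top>\<^bsub>\<lparr>carrier = C, eq = (=), le = (\<subseteq>)\<rparr>\<^esub> = U"
proof -
  let ?L = "\<lparr>carrier = C, eq = (=), le = (\<subseteq>)\<rparr>"
  have "greatest ?L U (carrier ?L)"
    using assms by (simp add: greatest_def)
  then show ?thesis
    unfolding top_def
    by (intro some_equality partial_order.greatest_unique[OF partial_order_inclusion])
qed

lemma (in ring) lattice_direct_sum_top_iff:
  assumes reg: "von_neumann_regular R" and x: "x \<in> carrier R" and y: "y \<in> carrier R"
  defines "L \<equiv> principal_right_ideal_lattice R"
  shows "lattice_direct_sum L (principal_right_ideal R x) (principal_right_ideal R y) \<top>\<^bsub>L\<^esub> \<longleftrightarrow>
    (\<exists>e\<in>idempotents R. principal_right_ideal R x = principal_right_ideal R e \<and>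
      principal_right_ideal R y = principal_right_ideal R (\<one> \<ominus> e))"
proof -
  let ?I = "principal_right_ideal R x" and ?J = "principal_right_ideal R y"
  define C where "C = principal_right_ideals_of R (carrier R)"
  have L: "L = \<lparr>carrier = C, eq = (=), le = (\<subseteq>)\<rparr>"
    by (simp add: L_def C_def principal_right_ideal_lattice_def)
  have C: "principal_right_ideal R w \<in> C" if "w \<in> carrier R" for w
    using that by (simp add: C_def principal_right_ideals_of_def)
  have C_cases: "\<exists>w\<in>carrier R. T = principal_right_ideal R w" if "T \<in> C" for T
    using that by (auto simp: C_def principal_right_ideals_of_def)
  have "?I \<sqinter>\<^bsub>L\<^esub> ?J = ?I \<inter> ?J"
    unfolding L using regular_inter_principal[OF reg x y] C x y
    by (intro inclusion_order_meet) auto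
  moreover have "?I \<squnion>\<^bsub>L\<^esub> ?J = ?I <+>\<^bsub>R\<^esub> ?J"
    unfolding L
  proof (rule inclusion_order_join)
    show "?I <+>\<^bsub>R\<^esub> ?J \<in> C"
      using regular_sum_principal[OF reg x y] C by auto
    have closed: "?I \<subseteq> carrier R" "?J \<subseteq> carrier R"
      using x y principal_right_ideal_closed by blast+
    have zero: "\<zero> \<in> ?I" "\<zero> \<in> ?J"
      using x y zero_mem_principal_right_ideal by blast+
    show "?I \<subseteq> ?I <+>\<^bsub>R\<^esub> ?J"
    proof
      fix z assume z: "z \<in> ?I"
      then have "z = z \<oplus> \<zero>"
        using closed by auto
      then show "z \<in> ?I <+>\<^bsub>R\<^esub> ?J"
        using z zero unfolding set_add_def' by blast
    qed
    show "?J \<subseteq> ?I <+>\<^bsub>R\<^esub> ?J"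
    proof
      fix z assume z: "z \<in> ?J"
      then have "z = \<zero> \<oplus> z"
        using closed by auto
      then show "z \<in> ?I <+>\<^bsub>R\<^esub> ?J"
        using z zero unfolding set_add_def' by blast
    qed
    fix T assume "T \<in> C" "?I \<subseteq> T" "?J \<subseteq> T"
    moreover obtain w where "w \<in> carrier R" "T = principal_right_ideal R w"
      using C_cases \<open>T \<in> C\<close> by blast
    ultimately show "?I <+>\<^bsub>R\<^esub> ?J \<subseteq> T"
      using principal_right_ideal_add_closed[of w] unfolding set_add_def' by blast
  qed (use C x y in auto)
  moreover have "\<bottom>\<^bsub>L\<^esub> = {\<zero>}"
    unfolding L using C[OF zero_closed] C_cases zero_mem_principal_right_ideal
    by (intro inclusion_order_bottom) (auto simp: principal_right_ideal_zero)
  moreover have "\<top>\<^bsub>L\<^esub> = carrier R"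
    unfolding L using C[OF one_closed] C_cases principal_right_ideal_closed
    by (intro inclusion_order_top) (auto simp: principal_right_ideal_one)
  ultimately show ?thesis
    using complementary_principal_right_ideals_iff[OF x y] by (simp add: lattice_direct_sum_def)
qed


section \<open>Banaschewski functions\<close>

theorem lemma3p5:
  fixes R :: "('a, 'm) ring_scheme" and X :: "'a set"
  assumes "ring R"
    and "von_neumann_regular R"
    and "X \<subseteq> carrier R"
  shows "(\<exists>f. lattice_partial_Banaschewski (principal_right_ideal_lattice R)
                 (principal_right_ideals_of R X) f) \<longleftrightarrow>
         (\<exists>f. ring_partial_Banaschewski R X f)"
proof -
  interpret ring R by fact
  let ?P = "principal_right_ideal R"
  let ?L = "principal_right_ideal_lattice R"
  have L: "carrier ?L = ?P ` carrier R" "\<And>A B. A \<sqsubseteq>\<^bsub>?L\<^esub> B \<longleftrightarrow> A \<subseteq> B"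
    by (simp_all add: principal_right_ideal_lattice_def principal_right_ideals_of_def)
  note split_iff = lattice_direct_sum_top_iff[OF assms(2)]
  show ?thesis
  proof
    assume "\<exists>f. lattice_partial_Banaschewski ?L (principal_right_ideals_of R X) f"
    then obtain f where "lattice_partial_Banaschewski ?L (principal_right_ideals_of R X) f" ..
    then have f: "\<And>x. x \<in> X \<Longrightarrow> f (?P x) \<in> ?P ` carrier R"
      and anti: "\<And>x y. \<lbrakk>x \<in> X; y \<in> X; ?P x \<subseteq> ?P y\<rbrakk> \<Longrightarrow> f (?P y) \<subseteq> f (?P x)"
      and sum: "\<And>x. x \<in> X \<Longrightarrow> lattice_direct_sum ?L (?P x) (f (?P x)) \<top>\<^bsub>?L\<^esub>"
      by (auto simp: lattice_partial_Banaschewski_def principal_right_ideals_of_def L)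
    have "\<exists>e. e \<in> idempotents R \<and> ?P x = ?P e \<and> f (?P x) = ?P (\<one>\<^bsub>R\<^esub> \<ominus>\<^bsub>R\<^esub> e)"
      if xX: "x \<in> X" for x
    proof -
      obtain y where y: "y \<in> carrier R" "f (?P x) = ?P y"
        using f[OF xX] by blast
      have x: "x \<in> carrier R"
        using xX assms(3) by blast
      show ?thesis
        using sum[OF xX] unfolding y(2) split_iff[OF x y(1)] by blast
    qed
    then obtain g where g: "\<And>x. x \<in> X \<Longrightarrow> g x \<in> idempotents R \<and> ?P x = ?P (g x) \<and>
        f (?P x) = ?P (\<one>\<^bsub>R\<^esub> \<ominus>\<^bsub>R\<^esub> g x)"
      by metis
    have "idempotent_le R (g x) (g y)" if "x \<in> X" "y \<in> X" "?P x \<subseteq> ?P y" for x y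
      using anti[OF that] g[OF that(1)] g[OF that(2)] that(3) by (metis idempotent_le_iff)
    then have "ring_partial_Banaschewski R X g"
      using g by (auto simp: ring_partial_Banaschewski_def)
    then show "\<exists>g. ring_partial_Banaschewski R X g" by blast
  next
    assume "\<exists>g. ring_partial_Banaschewski R X g"
    then obtain g where "ring_partial_Banaschewski R X g" ..
    then have g: "\<And>x. x \<in> X \<Longrightarrow> g x \<in> idempotents R"
      and gen: "\<And>x. x \<in> X \<Longrightarrow> ?P (g x) = ?P x"
      and mono: "\<And>x y. \<lbrakk>x \<in> X; y \<in> X; ?P x \<subseteq> ?P y\<rbrakk> \<Longrightarrow> idempotent_le R (g x) (g y)"
      by (auto simp: ring_partial_Banaschewski_def)
    have gc: "\<one>\<^bsub>R\<^esub> \<ominus>\<^bsub>R\<^esub> g x \<in> carrier R" if "x \<in> X" for x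
      using g[OF that] by (simp add: idempotents_def)
    \<comment> \<open>any choice of generators works: \<open>mono\<close> compares \<open>g\<close> only through the generated ideals\<close>
    define h where "h I = inv_into X ?P I" for I
    have h: "h (?P x) \<in> X" "?P (h (?P x)) = ?P x" if "x \<in> X" for x
      using that by (auto simp: h_def inv_into_into f_inv_into_f)
    define f where "f I = ?P (\<one>\<^bsub>R\<^esub> \<ominus>\<^bsub>R\<^esub> g (h I))" for I
    have "f (?P x) \<in> ?P ` carrier R" if "x \<in> X" for x
      using gc h that by (auto simp: f_def)
    moreover have "f (?P y) \<subseteq> f (?P x)" if "x \<in> X" "y \<in> X" "?P x \<subseteq> ?P y" for x y
      using mono[of "h (?P x)" "h (?P y)"] h g that by (simp add: f_def idempotent_le_iff)
    moreover have "lattice_direct_sum ?L (?P x) (f (?P x)) \<top>\<^bsub>?L\<^esub>" if "x \<in> X" for x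
    proof -
      have x: "x \<in> carrier R"
        using that assms(3) by blast
      have "?P x = ?P (g (h (?P x)))"
        using h[OF that] gen by simp
      then show ?thesis
        unfolding f_def split_iff[OF x gc[OF h(1)[OF that]]] using g[OF h(1)[OF that]] by blast
    qed
    ultimately have "lattice_partial_Banaschewski ?L (principal_right_ideals_of R X) f"
      by (auto simp: lattice_partial_Banaschewski_def principal_right_ideals_of_def L)
    then show "\<exists>f. lattice_partial_Banaschewski ?L (principal_right_ideals_of R X) f" by blast
  qed
qed

end
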